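(* Let $1\le m\le n$, let $M(q)$ and $\widehat M(q)$ be smooth symmetric positive definite $n\times n$ matrix-valued functions of $q\in\mathbb R^n$, and let $G(q)$ be a smooth $n\times m$ matrix-valued function with $\operatorname{rank}G(q)=m$ for each $q$. Let $G^\perp(q)=\{w\in\mathbb R^n: w^TG(q)=0\}$. Define the $(0,3)$-tensor field $S=S_{ijk}(q)\,e^i\otimes e^j\otimes e^k$ by $$S_{ijk}=-\frac12\widehat M_{k\ell}M^{\ell t}\frac{\partial\widehat M_{ij}}{\partial q^t}-\frac12\frac{\partial M^{rs}}{\partial q^k}\widehat M_{ri}\widehat M_{sj}.$$ Then there exists a gyroscopic $(0,3)$-tensor field $C\in\mathcal C(\mathbb R^n)$ satisfying the kinetic matching conditions $$w^T\Big(\partial_q(p^TM^{-1}p)-\widehat MM^{-1}\partial_q(p^T\widehat M^{-1}p)+2F_C(q,p)\Big)=0\qquad\text{for all } q,p\in\mathbb R^n,\ w\in G^\perp(q),$$ if and only if $$S(u,v,w)+S(v,w,u)+S(w,u,v)=0\qquad\text{for all } q\in\mathbb R^n \text{ and all } u,v,w\in G^\perp(q).$$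
   Context: All functions and tensor fields are smooth. $\{e_i\}$ is the standard basis of $\mathbb R^n$, $\{e^i\}$ its dual basis, and repeated indices are summed. $M^{ij}$, $\widehat M^{ij}$ denote the $(i,j)$ entries of $M^{-1}$, $\widehat M^{-1}$. A $(0,3)$-tensor $T=T_{ijk}e^i\otimes e^j\otimes e^k$ is identified with the trilinear map $T(u,v,w)=T_{ijk}u^iv^jw^k$. $\mathcal C(\mathbb R^n)$ is the set of $(0,3)$-tensor fields $C=C_{ijk}(q)e^i\otimes e^j\otimes e^k$ on $\mathbb R^n$ satisfying at each $q$, for all $i,j,k$: $C_{ijk}=C_{jik}$ and $C_{ijk}+C_{jki}+C_{kij}=0$. The gyroscopic force is the vector $F_C(q,p)=C_{ijk}\widehat M^{i\ell}\widehat M^{jr}p_\ell p_r\,e^k$. $\partial_q$ denotes the gradient with respect to $q$ with $p$ fixed. *)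

theory Defs
  imports "HOL-Analysis.Analysis"
begin

(* Total differentiability at each level makes every derivative of order at most k - 1
   continuous, so cont_diff k is the usual class C^k on the whole space. *)
primrec cont_diff :: "nat \<Rightarrow> ('a::real_normed_vector \<Rightarrow> 'b::real_normed_vector) \<Rightarrow> bool" where
  "cont_diff 0 f \<longleftrightarrow> continuous_on UNIV f"
| "cont_diff (Suc k) f \<longleftrightarrow>
     (\<forall>x. f differentiable (at x)) \<and> (\<forall>v. cont_diff k (\<lambda>x. frechet_derivative f (at x) v))"

definition smooth :: "('a::real_normed_vector \<Rightarrow> 'b::real_normed_vector) \<Rightarrow> bool" where
  "smooth f \<longleftrightarrow> (\<forall>k. cont_diff k f)"

definition partial_deriv :: "'n \<Rightarrow> (real^'n \<Rightarrow> real) \<Rightarrow> real^'n \<Rightarrow> real" where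
  "partial_deriv k f q = frechet_derivative f (at q) (axis k 1)"

definition grad :: "(real^'n \<Rightarrow> real) \<Rightarrow> real^'n \<Rightarrow> real^'n" where
  "grad f q = (\<chi> k. partial_deriv k f q)"

definition sym_pos_def :: "real^'n^'n \<Rightarrow> bool" where
  "sym_pos_def A \<longleftrightarrow> transpose A = A \<and> (\<forall>x. x \<noteq> 0 \<longrightarrow> x \<bullet> (A *v x) > 0)"

(* A (0,3)-tensor T is stored by its components in the standard basis:
   T_{ijk} is T $ i $ j $ k. *)
type_synonym 'n tensor3 = "real^'n^'n^'n"

definition tensor_app :: "'n tensor3 \<Rightarrow> real^'n \<Rightarrow> real^'n \<Rightarrow> real^'n \<Rightarrow> real" where
  "tensor_app T u v w = (\<Sum>i\<in>UNIV. \<Sum>j\<in>UNIV. \<Sum>k\<in>UNIV. T $ i $ j $ k * u $ i * v $ j * w $ k)"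

definition gyro_tensor_fields :: "(real^'n \<Rightarrow> 'n tensor3) set" where
  "gyro_tensor_fields = {C. smooth C \<and>
     (\<forall>q i j k. C q $ i $ j $ k = C q $ j $ i $ k \<and>
                C q $ i $ j $ k + C q $ j $ k $ i + C q $ k $ i $ j = 0)}"

definition gyro_force ::
  "(real^'n \<Rightarrow> real^'n^'n) \<Rightarrow> (real^'n \<Rightarrow> 'n tensor3) \<Rightarrow> real^'n \<Rightarrow> real^'n \<Rightarrow> real^'n" where
  "gyro_force Mh C q p =
     (\<chi> k. \<Sum>i\<in>UNIV. \<Sum>j\<in>UNIV. \<Sum>l\<in>UNIV. \<Sum>r\<in>UNIV.
        C q $ i $ j $ k * matrix_inv (Mh q) $ i $ l * matrix_inv (Mh q) $ j $ r * p $ l * p $ r)"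

definition left_annihilator :: "real^'m^'n \<Rightarrow> (real^'n) set" where
  "left_annihilator A = {w. w v* A = 0}"

definition S_tensor ::
  "(real^'n \<Rightarrow> real^'n^'n) \<Rightarrow> (real^'n \<Rightarrow> real^'n^'n) \<Rightarrow> real^'n \<Rightarrow> 'n tensor3" where
  "S_tensor M Mh q = (\<chi> i j k.
     - (1/2) * (\<Sum>l\<in>UNIV. \<Sum>t\<in>UNIV.
          Mh q $ k $ l * matrix_inv (M q) $ l $ t * partial_deriv t (\<lambda>x. Mh x $ i $ j) q)
     - (1/2) * (\<Sum>r\<in>UNIV. \<Sum>s\<in>UNIV.
          partial_deriv k (\<lambda>x. matrix_inv (M x) $ r $ s) q * Mh q $ r $ i * Mh q $ s $ j))"

definition kinetic_matching ::
  "(real^'n \<Rightarrow> real^'n^'n) \<Rightarrow> (real^'n \<Rightarrow> real^'n^'n) \<Rightarrow> (real^'n \<Rightarrow> real^'m^'n) \<Rightarrow>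
   (real^'n \<Rightarrow> 'n tensor3) \<Rightarrow> bool" where
  "kinetic_matching M Mh G C \<longleftrightarrow>
     (\<forall>q p. \<forall>w\<in>left_annihilator (G q).
        w \<bullet> (grad (\<lambda>x. p \<bullet> (matrix_inv (M x) *v p)) q
             - (Mh q ** matrix_inv (M q)) *v grad (\<lambda>x. p \<bullet> (matrix_inv (Mh x) *v p)) q
             + 2 *\<^sub>R gyro_force Mh C q p) = 0)"

end

theory Submission
  imports Defs
begin

text \<open>
  Every momentum has the form \<open>p = Mh(q) x\<close>, and in terms of \<open>x\<close> the matching condition says that
  \<open>C(x,x,w) = S(x,x,w)\<close> for all \<open>x\<close> and all \<open>w\<close> in the left annihilator of \<open>G(q)\<close>
  (\<open>matching_residual\<close>); the derivative of the inverse of \<open>Mh\<close> that occurs there becomes a derivative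
  of \<open>Mh\<close> by \<open>grad_quadratic_form_inverse\<close>. Both tensors are symmetric in their first two
  arguments, so by polarization \<open>C\<close> and \<open>S\<close> agree whenever the third argument is in the annihilator
  (\<open>kinetic_matching_iff\<close>). The cyclic sum of \<open>C\<close> vanishes, hence so does that of \<open>S\<close> on the
  annihilator.

  Conversely, let \<open>B\<close> be the cyclic sum of \<open>S\<close>, and let \<open>Q\<close> be the orthogonal projection onto the
  column space of \<open>G\<close>, whose kernel is the annihilator. One looks for \<open>C = S - T\<close>, where \<open>T\<close> is
  symmetric in its first two arguments, has cyclic sum \<open>B\<close>, and vanishes when its third argument is
  in the kernel of \<open>Q\<close>. Split each argument of \<open>B\<close> by \<open>Q\<close> and \<open>1 - Q\<close>. Each of the resulting
  terms has to be shared out among those cyclic positions in which the third argument lies in the range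
  of \<open>Q\<close>. The one term for which there is no such position is \<open>B\<close> on the kernel, and this is
  zero by hypothesis. Equal shares give \<open>cyclic_correction\<close>, whose cyclic sum is computed in
  \<open>cyclic_sum_cyclic_correction\<close>.

  The tensor field \<open>C\<close> is smooth because \<open>Q = G (G\<^sup>T G)\<^sup>-\<^sup>1 G\<^sup>T\<close> is given by one
  formula on the whole space and inversion of matrices preserves smoothness
  (\<open>smooth_matrix_inv\<close>).
\<close>

section \<open>The algebra of smooth functions\<close>

text \<open>Closure properties of \<open>cont_diff\<close> go by induction on the order. This rule and the next one
  replace the recursion through \<open>frechet_derivative\<close> by the usual calculus of
  \<open>has_derivative\<close>.\<close>

lemma cont_diff_SucI:
  assumes "\<And>x. (f has_derivative f' x) (at x)" "\<And>v. cont_diff k (\<lambda>x. f' x v)"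
  shows "cont_diff (Suc k) f"
proof -
  have "frechet_derivative f (at x) = f' x" for x
    using assms(1) frechet_derivative_at by metis
  then show ?thesis
    using assms by (auto simp: differentiable_def)
qed

lemma cont_diff_Suc_has_derivative:
  "cont_diff (Suc k) f \<Longrightarrow> (f has_derivative frechet_derivative f (at x)) (at x)"
  by (simp add: frechet_derivative_works)

lemma cont_diff_SucD: "cont_diff (Suc k) f \<Longrightarrow> cont_diff k f"
proof (induction k arbitrary: f)
  case 0
  then show ?case
    by (simp add: differentiable_imp_continuous_on differentiable_on_def)
next
  case (Suc k)
  from Suc.prems have "\<forall>x. f differentiable (at x)"
    and "\<forall>v. cont_diff (Suc k) (\<lambda>x. frechet_derivative f (at x) v)"
    by (subst (asm) cont_diff.simps(2), blast)+
  then show ?case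
    by (subst cont_diff.simps(2)) (use Suc.IH in blast)
qed

lemma cont_diff_const: "cont_diff k (\<lambda>x. c)"
proof (induction k arbitrary: c)
  case (Suc k)
  show ?case
    by (rule cont_diff_SucI[where f' = "\<lambda>x v. 0"]) (auto simp: Suc)
qed simp

lemma cont_diff_add: "cont_diff k f \<Longrightarrow> cont_diff k g \<Longrightarrow> cont_diff k (\<lambda>x. f x + g x)"
proof (induction k arbitrary: f g)
  case (Suc k)
  show ?case
    by (rule cont_diff_SucI[OF has_derivative_add[OF Suc.prems[THEN cont_diff_Suc_has_derivative]]])
      (use Suc in auto)
qed (simp add: continuous_on_add)

lemma cont_diff_bounded_linear:
  "bounded_linear h \<Longrightarrow> cont_diff k f \<Longrightarrow> cont_diff k (\<lambda>x. h (f x))"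
proof (induction k arbitrary: f)
  case 0
  then show ?case
    by (simp add: bounded_linear.continuous_on)
next
  case (Suc k)
  show ?case
    by (rule cont_diff_SucI[OF bounded_linear.has_derivative[OF Suc.prems(1)
            cont_diff_Suc_has_derivative[OF Suc.prems(2)]]])
      (use Suc in auto)
qed

lemma cont_diff_mult:
  fixes f g :: "'a::real_normed_vector \<Rightarrow> real"
  shows "cont_diff k f \<Longrightarrow> cont_diff k g \<Longrightarrow> cont_diff k (\<lambda>x. f x * g x)"
proof (induction k arbitrary: f g)
  case (Suc k)
  note fg = Suc.prems[THEN cont_diff_SucD]
  show ?case
    by (rule cont_diff_SucI[OF has_derivative_mult[OF Suc.prems[THEN cont_diff_Suc_has_derivative]]])
      (use Suc.prems fg in \<open>auto intro!: cont_diff_add Suc.IH\<close>)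
qed (simp add: continuous_on_mult)

lemma cont_diff_inverse:
  fixes f :: "'a::real_normed_vector \<Rightarrow> real"
  assumes "\<And>x. f x \<noteq> 0"
  shows "cont_diff k f \<Longrightarrow> cont_diff k (\<lambda>x. inverse (f x))"
proof (induction k)
  case 0
  then show ?case
    using assms by (simp add: continuous_on_inverse)
next
  case (Suc k)
  have inv: "cont_diff k (\<lambda>x. inverse (f x))"
    using Suc cont_diff_SucD by blast
  show ?case
  proof (rule cont_diff_SucI)
    show "((\<lambda>x. inverse (f x)) has_derivative
      (\<lambda>h. - (inverse (f x) * frechet_derivative f (at x) h * inverse (f x)))) (at x)" for x
      by (rule Deriv.has_derivative_inverse[OF assms cont_diff_Suc_has_derivative[OF Suc.prems]])
    show "cont_diff k (\<lambda>x. - (inverse (f x) * frechet_derivative f (at x) v * inverse (f x)))" for v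
      by (rule cont_diff_bounded_linear[OF bounded_linear_minus[OF bounded_linear_ident]])
        (use Suc.prems in \<open>auto intro!: cont_diff_mult inv\<close>)
  qed
qed

lemma smooth_const: "smooth (\<lambda>x. c)"
  by (simp add: smooth_def cont_diff_const)

lemma smooth_add: "smooth f \<Longrightarrow> smooth g \<Longrightarrow> smooth (\<lambda>x. f x + g x)"
  by (simp add: smooth_def cont_diff_add)

lemma smooth_bounded_linear: "bounded_linear h \<Longrightarrow> smooth f \<Longrightarrow> smooth (\<lambda>x. h (f x))"
  by (simp add: smooth_def cont_diff_bounded_linear)

lemma smooth_mult:
  fixes f g :: "'a::real_normed_vector \<Rightarrow> real"
  shows "smooth f \<Longrightarrow> smooth g \<Longrightarrow> smooth (\<lambda>x. f x * g x)"
  by (simp add: smooth_def cont_diff_mult)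

lemma smooth_inverse:
  fixes f :: "'a::real_normed_vector \<Rightarrow> real"
  shows "smooth f \<Longrightarrow> (\<And>x. f x \<noteq> 0) \<Longrightarrow> smooth (\<lambda>x. inverse (f x))"
  by (simp add: smooth_def cont_diff_inverse)

lemma smooth_diff:
  assumes "smooth f" "smooth g"
  shows "smooth (\<lambda>x. f x - g x)"
  using smooth_add[OF assms(1) smooth_bounded_linear[OF bounded_linear_minus[OF bounded_linear_ident] assms(2)]]
  by simp

lemma smooth_sum:
  assumes "\<And>i. i \<in> I \<Longrightarrow> smooth (f i)"
  shows "smooth (\<lambda>x. \<Sum>i\<in>I. f i x)"
  using assms by (induction I rule: infinite_finite_induct) (auto intro: smooth_const smooth_add)

lemma smooth_prod:
  fixes f :: "'i \<Rightarrow> 'a::real_normed_vector \<Rightarrow> real"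
  assumes "\<And>i. i \<in> I \<Longrightarrow> smooth (f i)"
  shows "smooth (\<lambda>x. \<Prod>i\<in>I. f i x)"
  using assms by (induction I rule: infinite_finite_induct) (auto intro: smooth_const smooth_mult)

lemma smooth_vec_nth: "smooth f \<Longrightarrow> smooth (\<lambda>x. f x $ i)"
  by (rule smooth_bounded_linear[OF bounded_linear_vec_nth])

text \<open>Writing a vector as the sum of its components placed along the axes reduces componentwise
  smoothness to composition with bounded linear maps, also when the components are themselves
  matrices or tensors.\<close>

lemma bounded_linear_axis: "bounded_linear (axis i :: 'b::real_normed_vector \<Rightarrow> 'b^'n)"
proof (rule bounded_linear_intro)
  show "norm (axis i x :: 'b^'n) \<le> norm x * 1" for x
  proof -
    have "norm (axis i x :: 'b^'n) \<le> (\<Sum>j\<in>UNIV. norm ((axis i x :: 'b^'n) $ j))"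
      unfolding norm_vec_def by (rule L2_set_le_sum) simp
    also have "\<dots> = norm x"
      by (simp add: axis_def if_distrib cong: if_cong)
    finally show ?thesis by simp
  qed
qed (auto simp: vec_eq_iff axis_def)

lemma smooth_vec_lambda:
  fixes f :: "'n::finite \<Rightarrow> 'a::real_normed_vector \<Rightarrow> 'b::real_normed_vector"
  assumes "\<And>i. smooth (f i)"
  shows "smooth (\<lambda>x. \<chi> i. f i x)"
proof -
  have "(\<lambda>x. \<chi> i. f i x) = (\<lambda>x. \<Sum>i\<in>UNIV. axis i (f i x))"
    by (simp add: fun_eq_iff vec_eq_iff axis_def)
  moreover have "smooth (\<lambda>x. \<Sum>i\<in>UNIV. axis i (f i x) :: 'b^'n)"
    by (intro smooth_sum smooth_bounded_linear[OF bounded_linear_axis] assms)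
  ultimately show ?thesis by simp
qed

lemma smooth_partial_deriv: "smooth f \<Longrightarrow> smooth (partial_deriv k f)"
  unfolding smooth_def partial_deriv_def[abs_def] by (metis cont_diff.simps(2))

lemma smooth_differentiable: "smooth f \<Longrightarrow> f differentiable (at x)"
  unfolding smooth_def by (metis cont_diff.simps(2))

section \<open>Smooth matrix-valued functions\<close>

lemma smooth_matrix_mult:
  fixes A :: "'a::real_normed_vector \<Rightarrow> real^'m^'n" and B :: "'a \<Rightarrow> real^'p^'m"
  shows "smooth A \<Longrightarrow> smooth B \<Longrightarrow> smooth (\<lambda>x. A x ** B x)"
  unfolding matrix_matrix_mult_def
  by (intro smooth_vec_lambda smooth_sum smooth_mult smooth_vec_nth)

lemma smooth_transpose:
  fixes A :: "'a::real_normed_vector \<Rightarrow> real^'m^'n"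
  shows "smooth A \<Longrightarrow> smooth (\<lambda>x. transpose (A x))"
  unfolding transpose_def by (intro smooth_vec_lambda smooth_vec_nth)

lemma smooth_matrix_vector_mult:
  fixes A :: "'a::real_normed_vector \<Rightarrow> real^'m^'n"
  shows "smooth A \<Longrightarrow> smooth v \<Longrightarrow> smooth (\<lambda>x. A x *v v x)"
  unfolding matrix_vector_mult_def
  by (intro smooth_vec_lambda smooth_sum smooth_mult smooth_vec_nth)

lemma smooth_det:
  fixes A :: "'a::real_normed_vector \<Rightarrow> real^'n^'n"
  shows "smooth A \<Longrightarrow> smooth (\<lambda>x. det (A x))"
  unfolding det_def by (intro smooth_sum smooth_mult smooth_prod smooth_vec_nth smooth_const)

lemma matrix_inv_mult:
  fixes A :: "'a::semiring_1^'n^'m"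
  assumes "invertible A"
  shows "A ** matrix_inv A = mat 1" "matrix_inv A ** A = mat 1"
  using someI_ex[OF assms[unfolded invertible_def]] by (auto simp: matrix_inv_def)

lemma matrix_inv_vector_mult:
  fixes A :: "real^'n^'n"
  assumes "invertible A"
  shows "A *v (matrix_inv A *v x) = x" "matrix_inv A *v (A *v x) = x"
  using matrix_inv_mult[OF assms] by (simp_all add: matrix_vector_mul_assoc)

text \<open>By Cramer's rule the entries of the inverse are quotients of determinants, hence rational
  functions of the entries of the matrix.\<close>

lemma smooth_matrix_inv:
  fixes A :: "'a::real_normed_vector \<Rightarrow> real^'n^'n"
  assumes "smooth A" "\<And>x. invertible (A x)"
  shows "smooth (\<lambda>x. matrix_inv (A x))"
proof -
  have det: "det (A x) \<noteq> 0" for x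
    using assms(2) by (simp add: invertible_det_nz)
  have entry: "matrix_inv (A x) $ k $ l =
    det (\<chi> i j. if j = k then axis l 1 $ i else A x $ i $ j) * inverse (det (A x))" for x k l
  proof -
    have "A x *v (matrix_inv (A x) *v axis l 1) = axis l 1"
      by (simp add: matrix_inv_vector_mult assms(2))
    then have "matrix_inv (A x) *v axis l 1 =
      (\<chi> k. det (\<chi> i j. if j = k then axis l 1 $ i else A x $ i $ j) / det (A x))"
      by (rule cramer[OF det, THEN iffD1])
    moreover have "matrix_inv (A x) $ k $ l = (matrix_inv (A x) *v axis l 1) $ k"
      by (simp add: matrix_vector_mul_component inner_axis)
    ultimately show ?thesis
      by (simp add: divide_inverse)
  qed
  have "smooth (\<lambda>x. \<chi> k l. matrix_inv (A x) $ k $ l)"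
    unfolding entry
  proof (intro smooth_vec_lambda smooth_mult smooth_inverse smooth_det assms(1) det)
    show "smooth (\<lambda>x. if j = k then axis l 1 $ i else A x $ i $ j)" for i j k l
      by (cases "j = k") (simp_all add: smooth_const smooth_vec_nth assms(1))
  qed
  then show ?thesis by simp
qed

section \<open>Components of trilinear maps\<close>

definition trilinear :: "('a::real_vector \<Rightarrow> 'a \<Rightarrow> 'a \<Rightarrow> real) \<Rightarrow> bool" where
  "trilinear f \<longleftrightarrow> (\<forall>v w. linear (\<lambda>u. f u v w)) \<and> (\<forall>u w. linear (\<lambda>v. f u v w))
     \<and> (\<forall>u v. linear (f u v))"

definition cyclic_sum :: "('a \<Rightarrow> 'a \<Rightarrow> 'a \<Rightarrow> real) \<Rightarrow> 'a \<Rightarrow> 'a \<Rightarrow> 'a \<Rightarrow> real" where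
  "cyclic_sum f u v w = f u v w + f v w u + f w u v"

lemma trilinear_rules:
  assumes "trilinear f"
  shows "f (u + u') v w = f u v w + f u' v w" "f u (v + v') w = f u v w + f u v' w"
    "f u v (w + w') = f u v w + f u v w'"
    "f (c *\<^sub>R u) v w = c * f u v w" "f u (c *\<^sub>R v) w = c * f u v w"
    "f u v (c *\<^sub>R w) = c * f u v w"
    "f (u - u') v w = f u v w - f u' v w" "f u (v - v') w = f u v w - f u v' w"
    "f u v (w - w') = f u v w - f u v w'"
  using assms unfolding trilinear_def
  by (auto simp: linear_iff linear_diff[of "\<lambda>u. f u v w"] linear_diff[of "\<lambda>v. f u v w"] linear_diff[of "f u v"])

lemma trilinearI:
  assumes "\<And>u u' v w. f (u + u') v w = f u v w + f u' v w"
    "\<And>u v v' w. f u (v + v') w = f u v w + f u v' w"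
    "\<And>u v w w'. f u v (w + w') = f u v w + f u v w'"
    "\<And>c u v w. f (c *\<^sub>R u) v w = c * f u v w"
    "\<And>c u v w. f u (c *\<^sub>R v) w = c * f u v w"
    "\<And>c u v w. f u v (c *\<^sub>R w) = c * f u v w"
  shows "trilinear f"
  using assms unfolding trilinear_def by (auto simp: linear_iff)

lemma trilinear_tensor_app: "trilinear (tensor_app T)"
  by (rule trilinearI)
    (simp_all add: tensor_app_def algebra_simps sum.distrib sum_distrib_left)

lemma tensor_app_axis: "tensor_app T (axis i 1) (axis j 1) (axis k 1) = T $ i $ j $ k"
  by (simp add: tensor_app_def axis_def if_distrib[of "\<lambda>x. _ * x"] cong: if_cong)

lemma linear_components:
  fixes f :: "real^'n \<Rightarrow> real"
  assumes "linear f"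
  shows "f x = (\<Sum>i\<in>UNIV. f (axis i 1) * x $ i)"
proof -
  have "f x = f (\<Sum>i\<in>UNIV. x $ i *\<^sub>R axis i 1)"
    by (simp add: basis_expansion flip: scalar_mult_eq_scaleR)
  also have "\<dots> = (\<Sum>i\<in>UNIV. f (axis i 1) * x $ i)"
    by (simp add: linear_sum[OF assms] linear_cmul[OF assms] mult.commute)
  finally show ?thesis .
qed

lemma tensor_app_of_components:
  assumes "trilinear f"
  shows "tensor_app (\<chi> i j k. f (axis i 1) (axis j 1) (axis k 1)) = f"
proof (intro ext)
  fix u v w
  have slot1: "f u v w = (\<Sum>i\<in>UNIV. f (axis i 1) v w * u $ i)" for v w
    using assms by (intro linear_components) (simp add: trilinear_def)
  have slot2: "f u v w = (\<Sum>j\<in>UNIV. f u (axis j 1) w * v $ j)" for u w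
    using assms by (intro linear_components) (simp add: trilinear_def)
  have slot3: "f u v w = (\<Sum>k\<in>UNIV. f u v (axis k 1) * w $ k)" for u v
    using assms by (intro linear_components) (simp add: trilinear_def)
  have "f u v w = (\<Sum>i\<in>UNIV. (\<Sum>j\<in>UNIV. (\<Sum>k\<in>UNIV.
      f (axis i 1) (axis j 1) (axis k 1) * w $ k) * v $ j) * u $ i)"
    unfolding slot1[of v w] slot2[of "axis _ 1" w] slot3[of "axis _ 1" "axis _ 1"] ..
  then show "tensor_app (\<chi> i j k. f (axis i 1) (axis j 1) (axis k 1)) u v w = f u v w"
    by (simp add: tensor_app_def sum_distrib_left sum_distrib_right mult_ac)
qed

lemma sum_rotate:
  "(\<Sum>i\<in>A. \<Sum>j\<in>B. \<Sum>k\<in>C. g i j k) = (\<Sum>j\<in>B. \<Sum>k\<in>C. \<Sum>i\<in>A. g i j k)"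
  by (subst sum.swap) (intro sum.cong refl sum.swap)

lemma tensor_app_rotate:
  "tensor_app T v w u = tensor_app (\<chi> i j k. T $ j $ k $ i) u v w"
  unfolding tensor_app_def by (subst (2) sum_rotate) (simp add: mult_ac)

lemma tensor_app_swap:
  "tensor_app T v u w = tensor_app (\<chi> i j k. T $ j $ i $ k) u v w"
  unfolding tensor_app_def by (subst sum.swap) (simp add: mult_ac)

lemma tensor_app_add: "tensor_app (S + T) u v w = tensor_app S u v w + tensor_app T u v w"
  by (simp add: tensor_app_def algebra_simps sum.distrib)

lemma smooth_tensor_app:
  assumes "smooth T" "smooth u" "smooth v" "smooth w"
  shows "smooth (\<lambda>x. tensor_app (T x) (u x) (v x) (w x))"
  unfolding tensor_app_def by (intro smooth_sum smooth_mult smooth_vec_nth assms)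

lemma tensor_app_symmetric:
  assumes "\<And>i j k. T $ i $ j $ k = T $ j $ i $ k"
  shows "tensor_app T u v w = tensor_app T v u w"
proof -
  have "(\<chi> i j k. T $ j $ i $ k) = T"
    using assms by (simp add: vec_eq_iff)
  then show ?thesis
    by (simp add: tensor_app_swap[of T v u w])
qed

lemma cyclic_sum_tensor_app:
  assumes "\<And>i j k. T $ i $ j $ k + T $ j $ k $ i + T $ k $ i $ j = 0"
  shows "cyclic_sum (tensor_app T) u v w = 0"
proof -
  have "cyclic_sum (tensor_app T) u v w
    = tensor_app (T + (\<chi> i j k. T $ j $ k $ i) + (\<chi> i j k. T $ k $ i $ j)) u v w"
    by (simp add: cyclic_sum_def tensor_app_add tensor_app_rotate[of T w u v]
        tensor_app_rotate[of _ v w u])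
  also have "T + (\<chi> i j k. T $ j $ k $ i) + (\<chi> i j k. T $ k $ i $ j) = 0"
    using assms by (simp add: vec_eq_iff)
  also have "tensor_app 0 u v w = 0"
    by (simp add: tensor_app_def)
  finally show ?thesis .
qed

text \<open>The index conditions on the components, freed of the basis: in this form they can be
  compared with the pointwise algebra below.\<close>

lemma gyro_tensor_fields_iff:
  "C \<in> gyro_tensor_fields \<longleftrightarrow> smooth C \<and>
     (\<forall>q u v w. tensor_app (C q) u v w = tensor_app (C q) v u w \<and>
        cyclic_sum (tensor_app (C q)) u v w = 0)" (is "?L \<longleftrightarrow> ?R")
proof
  assume ?L
  then show ?R
    by (auto simp: gyro_tensor_fields_def intro!: tensor_app_symmetric cyclic_sum_tensor_app)
next
  assume ?R
  then have "C q $ i $ j $ k = C q $ j $ i $ k"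
    and "C q $ i $ j $ k + C q $ j $ k $ i + C q $ k $ i $ j = 0" for q i j k
    unfolding cyclic_sum_def by (metis tensor_app_axis)+
  with \<open>?R\<close> show ?L
    unfolding gyro_tensor_fields_def by blast
qed

lemma trilinear_polarization:
  assumes "trilinear f" "trilinear g"
    and "\<And>u v. f u v w = f v u w" "\<And>u v. g u v w = g v u w"
    and "\<And>x. f x x w = g x x w"
  shows "f u v w = g u v w"
proof -
  have "f (u + v) (u + v) w = g (u + v) (u + v) w"
    by (rule assms)
  then show ?thesis
    using assms(5)[of u] assms(5)[of v] assms(3)[of u v] assms(4)[of u v]
    by (simp add: trilinear_rules[OF assms(1)] trilinear_rules[OF assms(2)])
qed

section \<open>Correcting the cyclic sum away from a subspace\<close>

text \<open>Let \<open>B\<close> be the cyclic sum of \<open>f\<close> and \<open>P = 1 - Q\<close>. The formula is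
  \<open>B(Pu,Pv,Qw) + 1/2 (B(Qu,Pv,Qw) + B(Pu,Qv,Qw)) + 1/3 B(Qu,Qv,Qw)\<close> rewritten in terms of \<open>Q\<close>
  alone. A term with one, two or three arguments in the range of \<open>Q\<close> is met that many times in the
  cyclic sum, hence the weights.\<close>

definition cyclic_correction ::
  "('a \<Rightarrow> 'a::real_vector) \<Rightarrow> ('a \<Rightarrow> 'a \<Rightarrow> 'a \<Rightarrow> real) \<Rightarrow> 'a \<Rightarrow> 'a \<Rightarrow> 'a \<Rightarrow> real" where
  "cyclic_correction Q f u v w =
     cyclic_sum f u v (Q w)
     - 1/2 * (cyclic_sum f (Q u) v (Q w) + cyclic_sum f u (Q v) (Q w))
     + 1/3 * cyclic_sum f (Q u) (Q v) (Q w)"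

lemma trilinear_minus_cyclic_correction:
  assumes "trilinear f" "linear Q"
  shows "trilinear (\<lambda>u v w. f u v w - cyclic_correction Q f u v w)"
  by (rule trilinearI)
    (simp_all add: cyclic_correction_def cyclic_sum_def trilinear_rules[OF assms(1)]
      linear_add[OF assms(2)] linear_cmul[OF assms(2)] algebra_simps)

lemma cyclic_correction_symmetric:
  assumes "\<And>u v w. f u v w = f v u w"
  shows "cyclic_correction Q f u v w = cyclic_correction Q f v u w"
proof -
  have "cyclic_sum f u v w = cyclic_sum f v u w" for u v w
    using assms[of u v] assms[of v w] assms[of w u] by (simp add: cyclic_sum_def)
  then show ?thesis
    by (simp add: cyclic_correction_def)
qed

lemma cyclic_correction_eq_0:
  assumes "trilinear f" "Q w = 0"
  shows "cyclic_correction Q f u v w = 0"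
  using assms trilinear_rules(4,5,6)[OF assms(1), where c = 0]
  by (simp add: cyclic_correction_def cyclic_sum_def)

text \<open>Inclusion and exclusion: the cyclic sum of the correction is
  \<open>B(u,v,w) - B(u - Q u, v - Q v, w - Q w)\<close> with \<open>B\<close> the cyclic sum of \<open>f\<close>, because \<open>B\<close> is
  totally symmetric. The second term is \<open>B\<close> on the kernel of \<open>Q\<close>.\<close>

lemma cyclic_sum_cyclic_correction:
  assumes "trilinear f" and symm: "\<And>u v w. f u v w = f v u w"
    and ker: "\<And>u. Q (u - Q u) = 0"
    and vanish: "\<And>u v w. Q u = 0 \<Longrightarrow> Q v = 0 \<Longrightarrow> Q w = 0 \<Longrightarrow> cyclic_sum f u v w = 0"
  shows "cyclic_sum (cyclic_correction Q f) u v w = cyclic_sum f u v w"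
proof -
  let ?B = "cyclic_sum f"
  have rot: "?B u v w = ?B v w u" for u v w
    by (simp add: cyclic_sum_def)
  have "0 = ?B (u - Q u) (v - Q v) (w - Q w)"
    by (simp add: vanish ker)
  also have "\<dots> = ?B u v w
      - (?B u v (Q w) + ?B v w (Q u) + ?B w u (Q v))
      + (?B u (Q v) (Q w) + ?B v (Q w) (Q u) + ?B w (Q u) (Q v))
      - ?B (Q u) (Q v) (Q w)"
    by (simp add: cyclic_sum_def trilinear_rules[OF assms(1)])
  finally show ?thesis
    using rot[of "Q u" v "Q w"] rot[of "Q v" w "Q u"] rot[of "Q w" u "Q v"]
      rot[of "Q u" "Q v" "Q w"] rot[of "Q v" "Q w" "Q u"]
    unfolding cyclic_sum_def[of "cyclic_correction Q f"] cyclic_correction_def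
    by (simp add: field_simps)
qed

section \<open>Positive definite matrices and projections\<close>

lemma sym_pos_def_invertible:
  assumes "sym_pos_def A"
  shows "invertible A"
proof -
  have "x = 0" if "A *v x = 0" for x
    using assms that unfolding sym_pos_def_def by (metis inner_zero_right less_irrefl)
  then show ?thesis
    using matrix_left_invertible_ker invertible_left_inverse by blast
qed

lemma sym_pos_def_matrix_inv_nonneg:
  assumes "sym_pos_def A"
  shows "0 \<le> y \<bullet> (matrix_inv A *v y)"
proof -
  have "0 \<le> x \<bullet> (A *v x)" for x
    using assms unfolding sym_pos_def_def by (cases "x = 0") (auto intro: less_imp_le)
  from this[of "matrix_inv A *v y"] show ?thesis
    by (simp add: matrix_inv_vector_mult sym_pos_def_invertible[OF assms] inner_commute)
qed

lemma transpose_matrix_inv: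
  fixes A :: "real^'n^'n"
  assumes "invertible A" "transpose A = A"
  shows "transpose (matrix_inv A) = matrix_inv A"
  by (metis assms matrix_inv_mult matrix_mul_assoc matrix_mul_lid matrix_mul_rid
      matrix_transpose_mul transpose_mat)

text \<open>For a matrix of full column rank this is the orthogonal projection onto its column space. The
  Gram matrix gives it without a choice of basis, so it depends smoothly on the matrix.\<close>

definition range_projection :: "real^'m^'n \<Rightarrow> real^'n^'n" where
  "range_projection A = A ** matrix_inv (transpose A ** A) ** transpose A"

lemma invertible_gram:
  fixes A :: "real^'m^'n"
  assumes "rank A = CARD('m)"
  shows "invertible (transpose A ** A)"
proof -
  have "x = 0" if "(transpose A ** A) *v x = 0" for x
  proof -
    have "x \<bullet> (transpose A *v (A *v x)) = 0"
      using that by (simp add: matrix_vector_mul_assoc del: transpose_matrix_vector)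
    then have "(A *v x) \<bullet> (A *v x) = 0"
      by (metis dot_lmul_matrix vector_transpose_matrix)
    then have "A *v x = A *v 0"
      by simp
    with full_rank_injective[THEN iffD1, OF assms] show ?thesis
      by (rule injD)
  qed
  then show ?thesis
    using matrix_left_invertible_ker invertible_left_inverse by blast
qed

lemma left_annihilator_iff: "w \<in> left_annihilator A \<longleftrightarrow> transpose A *v w = 0"
  by (simp add: left_annihilator_def)

lemma transpose_range_projection:
  fixes A :: "real^'m^'n"
  assumes "rank A = CARD('m)"
  shows "transpose A *v (range_projection A *v w) = transpose A *v w"
proof -
  have "transpose A ** range_projection A = transpose A"
    by (simp add: range_projection_def matrix_mul_assoc matrix_inv_mult invertible_gram[OF assms])
  then show ?thesis
    by (metis matrix_vector_mul_assoc)
qed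

lemma range_projection_eq_0_iff:
  fixes A :: "real^'m^'n"
  assumes "rank A = CARD('m)"
  shows "range_projection A *v w = 0 \<longleftrightarrow> w \<in> left_annihilator A"
proof
  assume "range_projection A *v w = 0"
  then show "w \<in> left_annihilator A"
    using transpose_range_projection[OF assms, of w]
    by (metis left_annihilator_iff matrix_vector_mult_0_right)
next
  assume "w \<in> left_annihilator A"
  then show "range_projection A *v w = 0"
    unfolding range_projection_def
    by (metis left_annihilator_iff matrix_vector_mul_assoc matrix_vector_mult_0_right)
qed

lemma range_projection_kernel:
  fixes A :: "real^'m^'n"
  assumes "rank A = CARD('m)"
  shows "range_projection A *v (w - range_projection A *v w) = 0"
  unfolding range_projection_eq_0_iff[OF assms] left_annihilator_iff
  by (simp only: matrix_vector_mult_diff_distrib transpose_range_projection[OF assms]) simp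

lemma smooth_range_projection:
  fixes G :: "'a::real_normed_vector \<Rightarrow> real^'m^'n"
  assumes "smooth G" "\<And>q. rank (G q) = CARD('m)"
  shows "smooth (\<lambda>q. range_projection (G q))"
  unfolding range_projection_def
  by (intro smooth_matrix_mult smooth_transpose smooth_matrix_inv invertible_gram assms)

section \<open>The matching conditions in terms of S\<close>

lemma quadratic_form_expand:
  fixes A :: "real^'n^'n"
  shows "x \<bullet> (A *v x) = (\<Sum>i\<in>UNIV. \<Sum>j\<in>UNIV. A $ i $ j * (x $ i * x $ j))"
  by (simp add: inner_vec_def matrix_vector_mult_def sum_distrib_left mult_ac)

lemma partial_deriv_quadratic_form:
  fixes A :: "real^'n \<Rightarrow> real^'n^'n"
  assumes "smooth A"
  shows "partial_deriv k (\<lambda>y. x \<bullet> (A y *v x)) q =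
    (\<Sum>i\<in>UNIV. \<Sum>j\<in>UNIV. partial_deriv k (\<lambda>y. A y $ i $ j) q * x $ i * x $ j)"
proof -
  have entry: "((\<lambda>y. A y $ i $ j) has_derivative frechet_derivative (\<lambda>y. A y $ i $ j) (at q)) (at q)" for i j
    by (simp add: smooth_differentiable smooth_vec_nth assms flip: frechet_derivative_works)
  have "((\<lambda>y. x \<bullet> (A y *v x)) has_derivative
    (\<lambda>h. \<Sum>i\<in>UNIV. \<Sum>j\<in>UNIV. frechet_derivative (\<lambda>y. A y $ i $ j) (at q) h * (x $ i * x $ j))) (at q)"
    unfolding quadratic_form_expand
    by (intro has_derivative_sum has_derivative_mult_left entry)
  from frechet_derivative_at[OF this, symmetric] show ?thesis
    by (simp add: partial_deriv_def mult_ac)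
qed

lemma smooth_quadratic_form:
  fixes A :: "real^'n \<Rightarrow> real^'n^'n"
  shows "smooth A \<Longrightarrow> smooth (\<lambda>y. x \<bullet> (A y *v x))"
  unfolding quadratic_form_expand by (intro smooth_sum smooth_mult smooth_const smooth_vec_nth)

text \<open>The forms \<open>1/2 x \<bullet> A x\<close> and \<open>1/2 p \<bullet> A\<^sup>-\<^sup>1 p\<close> are Legendre dual: the sum of the two
  exceeds \<open>p \<bullet> x\<close> by the nonnegative quantity
  \<open>1/2 (p - A x) \<bullet> A\<^sup>-\<^sup>1 (p - A x)\<close>. With \<open>p = A(q) x\<close> held fixed this is minimal at \<open>q\<close>, so its
  derivative vanishes there.\<close>

lemma grad_quadratic_form_inverse:
  fixes A :: "real^'n \<Rightarrow> real^'n^'n"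
  assumes "smooth A" and pos: "\<And>y. sym_pos_def (A y)"
  shows "grad (\<lambda>y. (A q *v x) \<bullet> (matrix_inv (A y) *v (A q *v x))) q
    = - grad (\<lambda>y. x \<bullet> (A y *v x)) q"
proof -
  define p where "p = A q *v x"
  let ?f = "\<lambda>y. p \<bullet> (matrix_inv (A y) *v p)" and ?g = "\<lambda>y. x \<bullet> (A y *v x)"
  note inv = sym_pos_def_invertible[OF pos]
  have "transpose (matrix_inv (A y)) = matrix_inv (A y)" for y
    using transpose_matrix_inv[OF inv] pos by (simp add: sym_pos_def_def)
  then have self: "a \<bullet> (matrix_inv (A y) *v b) = (matrix_inv (A y) *v a) \<bullet> b" for a b y
    by (metis dot_lmul_matrix transpose_matrix_vector)
  have eq: "?f y + ?g y - 2 * (p \<bullet> x) = (p - A y *v x) \<bullet> (matrix_inv (A y) *v (p - A y *v x))" for y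
    by (simp add: matrix_vector_mult_diff_distrib inner_diff_left inner_diff_right
        matrix_inv_vector_mult inv self[of "A y *v x"] inner_commute)
  have f: "(?f has_derivative frechet_derivative ?f (at q)) (at q)"
    using smooth_quadratic_form[OF smooth_matrix_inv[OF assms(1) inv]] smooth_differentiable
      frechet_derivative_works by blast
  have g: "(?g has_derivative frechet_derivative ?g (at q)) (at q)"
    using smooth_quadratic_form[OF assms(1)] smooth_differentiable frechet_derivative_works by blast
  have "((\<lambda>y. ?f y + ?g y - 2 * (p \<bullet> x)) has_derivative
    (\<lambda>h. frechet_derivative ?f (at q) h + frechet_derivative ?g (at q) h - 0)) (at q)"
    by (intro has_derivative_diff has_derivative_add f g has_derivative_const)
  moreover have "\<forall>y\<in>UNIV. ?f q + ?g q - 2 * (p \<bullet> x) \<le> ?f y + ?g y - 2 * (p \<bullet> x)"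
    unfolding eq by (simp add: p_def sym_pos_def_matrix_inv_nonneg[OF pos])
  ultimately have "(\<lambda>h. frechet_derivative ?f (at q) h + frechet_derivative ?g (at q) h - 0) = (\<lambda>h. 0)"
    by (intro differential_zero_maxmin[of q UNIV]) auto
  then have "frechet_derivative ?f (at q) h = - frechet_derivative ?g (at q) h" for h
    by (simp add: fun_eq_iff eq_neg_iff_add_eq_0)
  then show ?thesis
    by (simp add: grad_def partial_deriv_def vec_eq_iff flip: p_def)
qed

lemma tensor_app_contract:
  "tensor_app T u v w = w \<bullet> (\<chi> k. \<Sum>i\<in>UNIV. \<Sum>j\<in>UNIV. T $ i $ j $ k * u $ i * v $ j)"
proof -
  have "w \<bullet> (\<chi> k. \<Sum>i\<in>UNIV. \<Sum>j\<in>UNIV. T $ i $ j $ k * u $ i * v $ j)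
    = (\<Sum>k\<in>UNIV. \<Sum>i\<in>UNIV. \<Sum>j\<in>UNIV. T $ i $ j $ k * u $ i * v $ j * w $ k)"
    by (simp add: inner_vec_def sum_distrib_left mult_ac)
  also have "\<dots> = tensor_app T u v w"
    unfolding tensor_app_def by (rule sum_rotate)
  finally show ?thesis ..
qed

lemma gyro_force_eq:
  assumes "invertible (Mh q)"
  shows "gyro_force Mh C q (Mh q *v x) = (\<chi> k. \<Sum>i\<in>UNIV. \<Sum>j\<in>UNIV. C q $ i $ j $ k * x $ i * x $ j)"
proof -
  let ?A = "matrix_inv (Mh q)" and ?p = "Mh q *v x"
  have x: "x $ i = (\<Sum>l\<in>UNIV. ?A $ i $ l * ?p $ l)" for i
    using matrix_inv_vector_mult(2)[OF assms, of x]
    by (metis (no_types, lifting) matrix_vector_mult_def vec_lambda_beta sum.cong)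
  have "(\<Sum>l\<in>UNIV. \<Sum>r\<in>UNIV. c * ?A $ i $ l * ?A $ j $ r * ?p $ l * ?p $ r) = c * x $ i * x $ j" for c i j
    unfolding x[of i] x[of j] by (simp add: sum_distrib_left sum_distrib_right mult_ac)
  then show ?thesis
    by (simp add: gyro_force_def)
qed

text \<open>Up to the factor \<open>-1/2\<close>, the two summands of \<open>S\<close> are the coefficients of the two gradients in the matching
  condition, as quadratic forms in \<open>x\<close>; the proof only reorders finite sums.\<close>

lemma S_tensor_diagonal:
  assumes "smooth M" "smooth Mh" "\<And>q. invertible (M q)"
  shows "(\<chi> k. \<Sum>i\<in>UNIV. \<Sum>j\<in>UNIV. S_tensor M Mh q $ i $ j $ k * x $ i * x $ j) =
    - (1/2) *\<^sub>R (grad (\<lambda>y. (Mh q *v x) \<bullet> (matrix_inv (M y) *v (Mh q *v x))) q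
      + (Mh q ** matrix_inv (M q)) *v grad (\<lambda>y. x \<bullet> (Mh y *v x)) q)"
proof -
  let ?A = "matrix_inv (M q)" and ?p = "Mh q *v x"
  let ?N = "\<lambda>i j t. partial_deriv t (\<lambda>y. Mh y $ i $ j) q"
  let ?D = "\<lambda>r s k. partial_deriv k (\<lambda>y. matrix_inv (M y) $ r $ s) q"
  have first: "((Mh q ** ?A) *v grad (\<lambda>y. x \<bullet> (Mh y *v x)) q) $ k =
    (\<Sum>i\<in>UNIV. \<Sum>j\<in>UNIV. (\<Sum>l\<in>UNIV. \<Sum>t\<in>UNIV. Mh q $ k $ l * ?A $ l $ t * ?N i j t) * (x $ i * x $ j))" for k
  proof -
    have "((Mh q ** ?A) *v g) $ k = (\<Sum>l\<in>UNIV. Mh q $ k $ l * (\<Sum>t\<in>UNIV. ?A $ l $ t * g $ t))" for g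
      by (subst matrix_vector_mul_assoc[symmetric])
        (simp only: matrix_vector_mult_def vec_lambda_beta)
    then have "((Mh q ** ?A) *v grad (\<lambda>y. x \<bullet> (Mh y *v x)) q) $ k =
      (\<Sum>l\<in>UNIV. \<Sum>t\<in>UNIV. \<Sum>i\<in>UNIV. \<Sum>j\<in>UNIV. Mh q $ k $ l * ?A $ l $ t * ?N i j t * (x $ i * x $ j))"
      by (simp add: grad_def partial_deriv_quadratic_form[OF assms(2)] sum_distrib_left mult_ac)
    also have "\<dots> = (\<Sum>i\<in>UNIV. \<Sum>j\<in>UNIV. \<Sum>l\<in>UNIV. \<Sum>t\<in>UNIV. Mh q $ k $ l * ?A $ l $ t * ?N i j t * (x $ i * x $ j))"
      by (subst sum_rotate[symmetric], subst (2) sum_rotate[symmetric]) (rule refl)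
    finally show ?thesis
      by (simp add: sum_distrib_right)
  qed
  have second: "grad (\<lambda>y. ?p \<bullet> (matrix_inv (M y) *v ?p)) q $ k =
    (\<Sum>i\<in>UNIV. \<Sum>j\<in>UNIV. (\<Sum>r\<in>UNIV. \<Sum>s\<in>UNIV. ?D r s k * Mh q $ r $ i * Mh q $ s $ j) * (x $ i * x $ j))" for k
  proof -
    have "grad (\<lambda>y. ?p \<bullet> (matrix_inv (M y) *v ?p)) q $ k
      = (\<Sum>r\<in>UNIV. \<Sum>s\<in>UNIV. ?D r s k * ?p $ r * ?p $ s)"
      by (simp add: grad_def partial_deriv_quadratic_form[OF smooth_matrix_inv[OF assms(1,3)]])
    also have "\<dots> = (\<Sum>r\<in>UNIV. \<Sum>s\<in>UNIV. \<Sum>i\<in>UNIV. \<Sum>j\<in>UNIV. ?D r s k * Mh q $ r $ i * Mh q $ s $ j * (x $ i * x $ j))"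
      unfolding matrix_vector_mult_def vec_lambda_beta
      by (simp add: sum_distrib_left sum_distrib_right mult_ac)
    also have "\<dots> = (\<Sum>i\<in>UNIV. \<Sum>j\<in>UNIV. \<Sum>r\<in>UNIV. \<Sum>s\<in>UNIV. ?D r s k * Mh q $ r $ i * Mh q $ s $ j * (x $ i * x $ j))"
      by (subst sum_rotate[symmetric], subst (2) sum_rotate[symmetric]) (rule refl)
    finally show ?thesis
      by (simp add: sum_distrib_right)
  qed
  have half: "(\<Sum>i\<in>UNIV. \<Sum>j\<in>UNIV. (- (1/2) * a i j - (1/2) * b i j) * x $ i * x $ j) =
    - (1/2) * ((\<Sum>i\<in>UNIV. \<Sum>j\<in>UNIV. b i j * (x $ i * x $ j))
      + (\<Sum>i\<in>UNIV. \<Sum>j\<in>UNIV. a i j * (x $ i * x $ j)))" for a b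
    unfolding sum_distrib_left sum.distrib[symmetric]
    by (intro sum.cong refl) (simp add: field_simps)
  show ?thesis
    unfolding vec_eq_iff vector_scaleR_component vector_add_component first second
      S_tensor_def vec_lambda_beta half by simp
qed

text \<open>The substitution \<open>p = Mh(q) x\<close> removes the inverses of \<open>Mh\<close> from the gyroscopic force
  and produces the two factors of \<open>Mh\<close> in the second summand of \<open>S\<close>.\<close>

lemma matching_residual:
  assumes "smooth M" "\<And>q. sym_pos_def (M q)" "smooth Mh" "\<And>q. sym_pos_def (Mh q)"
    and p: "p = Mh q *v x"
  shows "w \<bullet> (grad (\<lambda>y. p \<bullet> (matrix_inv (M y) *v p)) q
      - (Mh q ** matrix_inv (M q)) *v grad (\<lambda>y. p \<bullet> (matrix_inv (Mh y) *v p)) q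
      + 2 *\<^sub>R gyro_force Mh C q p)
    = 2 * (tensor_app (C q) x x w - tensor_app (S_tensor M Mh q) x x w)"
proof -
  have C: "tensor_app (C q) x x w = w \<bullet> gyro_force Mh C q p"
    by (simp only: p tensor_app_contract gyro_force_eq[of Mh, OF sym_pos_def_invertible[OF assms(4)]])
  have S: "tensor_app (S_tensor M Mh q) x x w =
    w \<bullet> (- (1/2) *\<^sub>R (grad (\<lambda>y. p \<bullet> (matrix_inv (M y) *v p)) q
      + (Mh q ** matrix_inv (M q)) *v grad (\<lambda>y. x \<bullet> (Mh y *v x)) q))"
    by (simp only: p tensor_app_contract
        S_tensor_diagonal[OF assms(1,3) sym_pos_def_invertible[OF assms(2)]])
  have "grad (\<lambda>y. p \<bullet> (matrix_inv (Mh y) *v p)) q = - grad (\<lambda>y. x \<bullet> (Mh y *v x)) q"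
    unfolding p by (rule grad_quadratic_form_inverse[OF assms(3,4)])
  moreover have "(Mh q ** matrix_inv (M q)) *v (- g) = - ((Mh q ** matrix_inv (M q)) *v g)" for g
    using matrix_vector_mult_diff_distrib[of _ 0 g] by simp
  ultimately show ?thesis
    unfolding C S by (simp add: inner_add_right inner_diff_right)
qed

lemma tensor_app_S_tensor_symmetric:
  assumes "\<And>q. sym_pos_def (M q)" "\<And>q. sym_pos_def (Mh q)"
  shows "tensor_app (S_tensor M Mh q) u v w = tensor_app (S_tensor M Mh q) v u w"
proof (rule tensor_app_symmetric)
  have entry: "A $ i $ j = A $ j $ i" if "transpose A = A" for A :: "real^'a^'a" and i j
    using that by (metis transpose_def vec_lambda_beta)
  have Mh: "Mh y $ i $ j = Mh y $ j $ i" for y i j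
    using entry assms(2) unfolding sym_pos_def_def by blast
  have "matrix_inv (M y) $ r $ s = matrix_inv (M y) $ s $ r" for y r s
    using entry transpose_matrix_inv sym_pos_def_invertible assms(1) unfolding sym_pos_def_def by metis
  then have D: "partial_deriv k (\<lambda>y. matrix_inv (M y) $ r $ s) q
      = partial_deriv k (\<lambda>y. matrix_inv (M y) $ s $ r) q" for k r s
    by metis
  fix i j k
  have "(\<Sum>r\<in>UNIV. \<Sum>s\<in>UNIV. partial_deriv k (\<lambda>y. matrix_inv (M y) $ r $ s) q * Mh q $ r $ i * Mh q $ s $ j)
    = (\<Sum>r\<in>UNIV. \<Sum>s\<in>UNIV. partial_deriv k (\<lambda>y. matrix_inv (M y) $ r $ s) q * Mh q $ r $ j * Mh q $ s $ i)"
    by (subst sum.swap, subst D) (simp add: mult_ac)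
  then show "S_tensor M Mh q $ i $ j $ k = S_tensor M Mh q $ j $ i $ k"
    unfolding S_tensor_def vec_lambda_beta Mh[of _ i j] by simp
qed

lemma smooth_S_tensor:
  assumes "smooth M" "\<And>q. invertible (M q)" "smooth Mh"
  shows "smooth (S_tensor M Mh)"
  unfolding S_tensor_def[abs_def]
  by (intro smooth_vec_lambda smooth_diff smooth_mult smooth_sum smooth_const smooth_partial_deriv
      smooth_vec_nth smooth_matrix_inv assms)

text \<open>For a fixed \<open>w\<close> both sides are symmetric bilinear in \<open>u\<close> and \<open>v\<close>, so it is enough that they
  agree for \<open>u = v\<close>; and since \<open>Mh(q)\<close> is invertible, the momenta \<open>Mh(q) x\<close> are all momenta.\<close>

lemma kinetic_matching_iff:
  assumes "smooth M" "\<And>q. sym_pos_def (M q)" "smooth Mh" "\<And>q. sym_pos_def (Mh q)"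
    and C: "C \<in> gyro_tensor_fields"
  shows "kinetic_matching M Mh G C \<longleftrightarrow> (\<forall>q u v. \<forall>w\<in>left_annihilator (G q).
    tensor_app (C q) u v w = tensor_app (S_tensor M Mh q) u v w)" (is "_ \<longleftrightarrow> ?R")
proof -
  note residual = matching_residual[OF assms(1-4)]
  have "kinetic_matching M Mh G C \<longleftrightarrow> (\<forall>q x. \<forall>w\<in>left_annihilator (G q).
    tensor_app (C q) x x w = tensor_app (S_tensor M Mh q) x x w)" (is "_ \<longleftrightarrow> ?D")
  proof
    assume match: "kinetic_matching M Mh G C"
    show ?D
    proof (intro allI ballI)
      fix q x w assume "w \<in> left_annihilator (G q)"
      then show "tensor_app (C q) x x w = tensor_app (S_tensor M Mh q) x x w"
        using match[unfolded kinetic_matching_def, rule_format, of w q "Mh q *v x"]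
          residual[OF refl, of w q x C] by simp
    qed
  next
    assume D: ?D
    show "kinetic_matching M Mh G C"
      unfolding kinetic_matching_def
    proof (intro allI ballI)
      fix q p w assume w: "w \<in> left_annihilator (G q)"
      have "p = Mh q *v (matrix_inv (Mh q) *v p)"
        by (simp add: matrix_inv_vector_mult sym_pos_def_invertible assms(4))
      from residual[OF this, of w C] D w
      show "w \<bullet> (grad (\<lambda>y. p \<bullet> (matrix_inv (M y) *v p)) q
          - (Mh q ** matrix_inv (M q)) *v grad (\<lambda>y. p \<bullet> (matrix_inv (Mh y) *v p)) q
          + 2 *\<^sub>R gyro_force Mh C q p) = 0"
        by simp
    qed
  qed
  also have "?D \<longleftrightarrow> ?R"
  proof
    assume D: ?D
    show ?R
    proof (intro allI ballI)
      fix q u v w assume w: "w \<in> left_annihilator (G q)"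
      show "tensor_app (C q) u v w = tensor_app (S_tensor M Mh q) u v w"
      proof (rule trilinear_polarization[OF trilinear_tensor_app trilinear_tensor_app])
        show "tensor_app (C q) u v w = tensor_app (C q) v u w" for u v
          using C by (simp add: gyro_tensor_fields_iff)
        show "tensor_app (S_tensor M Mh q) u v w = tensor_app (S_tensor M Mh q) v u w" for u v
          by (rule tensor_app_S_tensor_symmetric[OF assms(2,4)])
        show "tensor_app (C q) x x w = tensor_app (S_tensor M Mh q) x x w" for x
          using D w by simp
      qed
    qed
  qed simp
  finally show ?thesis .
qed

theorem mainTheorem4:
  fixes M Mh :: "real^'n \<Rightarrow> real^'n^'n"
    and G :: "real^'n \<Rightarrow> real^'m^'n"
  assumes "CARD('m) \<le> CARD('n)"
    and "smooth M" and "\<And>q. sym_pos_def (M q)"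
    and "smooth Mh" and "\<And>q. sym_pos_def (Mh q)"
    and "smooth G" and "\<And>q. rank (G q) = CARD('m)"
  shows "(\<exists>C\<in>gyro_tensor_fields. kinetic_matching M Mh G C) \<longleftrightarrow>
    (\<forall>q. \<forall>u\<in>left_annihilator (G q). \<forall>v\<in>left_annihilator (G q). \<forall>w\<in>left_annihilator (G q).
       tensor_app (S_tensor M Mh q) u v w + tensor_app (S_tensor M Mh q) v w u
       + tensor_app (S_tensor M Mh q) w u v = 0)"
proof
  assume "\<exists>C\<in>gyro_tensor_fields. kinetic_matching M Mh G C"
  then obtain C where C: "C \<in> gyro_tensor_fields" and "kinetic_matching M Mh G C" ..
  then have S: "tensor_app (S_tensor M Mh q) u v w = tensor_app (C q) u v w"
    if "w \<in> left_annihilator (G q)" for q u v w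
    using that kinetic_matching_iff[OF assms(2-5) C, of G] by metis
  have "cyclic_sum (tensor_app (C q)) u v w = 0" for q u v w
    using C by (simp add: gyro_tensor_fields_iff)
  then show "\<forall>q. \<forall>u\<in>left_annihilator (G q). \<forall>v\<in>left_annihilator (G q). \<forall>w\<in>left_annihilator (G q).
       tensor_app (S_tensor M Mh q) u v w + tensor_app (S_tensor M Mh q) v w u
       + tensor_app (S_tensor M Mh q) w u v = 0"
    by (simp add: S cyclic_sum_def)
next
  assume cyc: "\<forall>q. \<forall>u\<in>left_annihilator (G q). \<forall>v\<in>left_annihilator (G q). \<forall>w\<in>left_annihilator (G q).
       tensor_app (S_tensor M Mh q) u v w + tensor_app (S_tensor M Mh q) v w u
       + tensor_app (S_tensor M Mh q) w u v = 0"
  define S where "S q = tensor_app (S_tensor M Mh q)" for q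
  define Q where "Q q = (\<lambda>w. range_projection (G q) *v w)" for q
  define f where "f q u v w = S q u v w - cyclic_correction (Q q) (S q) u v w" for q u v w
  define C :: "real^'n \<Rightarrow> 'n tensor3"
    where "C q = (\<chi> i j k. f q (axis i 1) (axis j 1) (axis k 1))" for q
  have tri: "trilinear (S q)" and sym: "S q u v w = S q v u w" for q u v w
    unfolding S_def by (rule trilinear_tensor_app tensor_app_S_tensor_symmetric[OF assms(3,5)])+
  have Q0: "Q q w = 0 \<longleftrightarrow> w \<in> left_annihilator (G q)" for q w
    by (simp add: Q_def range_projection_eq_0_iff assms(7))
  have "trilinear (f q)" for q
    unfolding f_def[abs_def] using tri
    by (rule trilinear_minus_cyclic_correction) (simp add: Q_def)
  then have app: "tensor_app (C q) = f q" for q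
    unfolding C_def by (rule tensor_app_of_components)
  have f_sym: "f q u v w = f q v u w" for q u v w
    using sym[of q u v w] cyclic_correction_symmetric[of "S q", OF sym, of "Q q" u v w]
    by (simp add: f_def)
  have "cyclic_sum (cyclic_correction (Q q) (S q)) u v w = cyclic_sum (S q) u v w" for q u v w
  proof (rule cyclic_sum_cyclic_correction[OF tri sym])
    show "Q q (u - Q q u) = 0" for u
      by (simp only: Q_def range_projection_kernel[OF assms(7)])
    show "cyclic_sum (S q) u v w = 0" if "Q q u = 0" "Q q v = 0" "Q q w = 0" for u v w
      using that cyc by (simp add: Q0 cyclic_sum_def S_def)
  qed
  then have f_cyc: "cyclic_sum (f q) u v w = 0" for q u v w
    by (simp add: cyclic_sum_def f_def algebra_simps)
  have "smooth C"
    unfolding C_def[abs_def] f_def cyclic_correction_def cyclic_sum_def S_def Q_def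
    by (intro smooth_vec_lambda smooth_diff smooth_add smooth_mult smooth_const smooth_tensor_app
        smooth_matrix_vector_mult smooth_range_projection smooth_S_tensor sym_pos_def_invertible assms)
  then have C: "C \<in> gyro_tensor_fields"
    by (simp only: gyro_tensor_fields_iff app f_cyc) (use f_sym in blast)
  have "tensor_app (C q) u v w = tensor_app (S_tensor M Mh q) u v w"
    if "w \<in> left_annihilator (G q)" for q u v w
    using that cyclic_correction_eq_0[OF tri, of "Q q" w q u v]
    by (simp add: app f_def Q0) (simp add: S_def)
  then have "kinetic_matching M Mh G C"
    using kinetic_matching_iff[OF assms(2-5) C] by blast
  with C show "\<exists>C\<in>gyro_tensor_fields. kinetic_matching M Mh G C"
    by blast
qed

end
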